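(* Let $\Gamma$ be a mixed graph with Hermitian adjacency matrix $H$, let $\theta_0,\ldots,\theta_d$ be the distinct eigenvalues of $H$ with spectral idempotents $E_{\theta_0},\ldots,E_{\theta_d}$, and let $u$ and $v$ be two distinct vertices of $\Gamma$. Then the following statements are equivalent: (i) There is zero transfer between vertices $u$ and $v$. (ii) For every eigenvalue $\theta_r$, $(E_{\theta_r})_{u,v}=0$. Moreover, (ii) is equivalent to: either $\Phi_u\cap\Phi_v=\emptyset$, or $(E_{\theta_r})_{u,v}=0$ for all $\theta_r\in\Phi_u\cap\Phi_v$.
   Context: A mixed graph $\Gamma=(V,E,A)$ consists of a finite vertex set $V$, a set $E$ of undirected edges and a set $A$ of directed edges (arcs), with no loops and at most one edge or arc between any two vertices. Its Hermitian adjacency matrix $H=(h_{uv})_{u,v\in V}$ is defined by $h_{uv}=1$ if $\{u,v\}\in E$, $h_{uv}=\mathrm{i}$ if $(u,v)\in A$, $h_{uv}=-\mathrm{i}$ if $(v,u)\in A$, and $h_{uv}=0$ otherwise, where $\mathrm{i}=\sqrt{-1}$. The transition matrix is $U(t)=\exp(-\mathrm{i}tH)$, $t\in\mathbb{R}$. There is zero transfer between vertices $u$ and $v$ if $U(t)_{u,v}=0$ for all $t\ge 0$ (this condition is symmetric in $u$ and $v$). The spectral idempotent $E_{\theta_r}$ is the orthogonal projection onto the $\theta_r$-eigenspace of $H$, so $H=\sum_{r=0}^d\theta_rE_{\theta_r}$. For a vertex $a$, $\mathbf{e}_a$ is the standard basis vector indexed by $a$, and the eigenvalue support of $a$ is $\Phi_a=\{\theta_r: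 E_{\theta_r}\mathbf{e}_a\neq\mathbf{0}\}$. *)

theory Defs
  imports "HOL-Analysis.Analysis"
begin

text \<open>The vertex set is the finite type \<open>'v\<close>. An undirected edge is an unordered pair, that is, a
  two-element set of vertices; an arc is an ordered pair.\<close>

locale mixed_graph =
  fixes E :: "'v::finite set set" and A :: "('v \<times> 'v) set"
  assumes edges: "e \<in> E \<Longrightarrow> card e = 2"
    and no_arc_loop: "(u, u) \<notin> A"
    and arc_not_edge: "(u, v) \<in> A \<Longrightarrow> {u, v} \<notin> E"
    and arc_not_reversed: "(u, v) \<in> A \<Longrightarrow> (v, u) \<notin> A"

definition herm_adj :: "'v::finite set set \<Rightarrow> ('v \<times> 'v) set \<Rightarrow> complex ^ 'v ^ 'v" where
  "herm_adj E A = (\<chi> u v.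
     if {u, v} \<in> E then 1
     else if (u, v) \<in> A then \<i>
     else if (v, u) \<in> A then - \<i>
     else 0)"

definition mat_pow :: "complex ^ 'v ^ 'v \<Rightarrow> nat \<Rightarrow> complex ^ 'v ^ 'v::finite" where
  "mat_pow M k = ((\<lambda>N. M ** N) ^^ k) (mat 1)"

text \<open>The library multiplication on \<^typ>\<open>complex ^ 'v ^ 'v\<close> is componentwise, and matrices are not
  an instance of the classes on which \<^const>\<open>exp\<close> is defined, so the exponential series is written
  out with the matrix product.\<close>

definition mat_exp :: "complex ^ 'v ^ 'v \<Rightarrow> complex ^ 'v ^ 'v::finite" where
  "mat_exp M = (\<Sum>k. (1 / fact k) *\<^sub>R mat_pow M k)"

lemma mat_pow_entry_bound:
  fixes M :: "complex ^ 'v ^ 'v::finite"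
  assumes "\<And>i j. norm (M $ i $ j) \<le> c"
  shows "norm (mat_pow M k $ i $ j) \<le> (real CARD('v) * c) ^ k"
proof (induction k arbitrary: i j)
  case 0
  then show ?case by (simp add: mat_pow_def mat_def)
next
  case (Suc k)
  have c: "0 \<le> c" using assms norm_ge_zero order_trans by blast
  have "norm (mat_pow M (Suc k) $ i $ j) = norm (\<Sum>l\<in>UNIV. M $ i $ l * mat_pow M k $ l $ j)"
    by (simp add: mat_pow_def matrix_matrix_mult_def)
  also have "\<dots> \<le> (\<Sum>l\<in>(UNIV::'v set). c * (real CARD('v) * c) ^ k)"
    by (intro sum_norm_le) (auto simp: norm_mult intro!: mult_mono assms Suc c)
  finally show ?case by simp
qed

lemma mat_exp_summable:
  fixes M :: "complex ^ 'v ^ 'v::finite"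
  shows "summable (\<lambda>k. (1 / fact k) *\<^sub>R mat_pow M k)"
proof -
  define c where "c = norm M"
  have c: "norm (M $ i $ j) \<le> c" for i j
    unfolding c_def by (meson Finite_Cartesian_Product.norm_nth_le order_trans)
  define q where "q = real CARD('v) * c"
  define B where "B = real CARD('v) * real CARD('v)"
  have row: "norm (mat_pow M k $ i) \<le> real CARD('v) * q ^ k" for k i
  proof -
    have "norm (mat_pow M k $ i) \<le> (\<Sum>j\<in>UNIV. norm (mat_pow M k $ i $ j))"
      by (simp add: norm_vec_def L2_set_le_sum)
    also have "\<dots> \<le> (\<Sum>j\<in>(UNIV::'v set). q ^ k)"
      unfolding q_def by (intro sum_mono mat_pow_entry_bound c)
    finally show ?thesis by simp
  qed
  have bound: "norm (mat_pow M k) \<le> B * q ^ k" for k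
  proof -
    have "norm (mat_pow M k) \<le> (\<Sum>i\<in>UNIV. norm (mat_pow M k $ i))"
      by (simp add: norm_vec_def L2_set_le_sum)
    also have "\<dots> \<le> (\<Sum>i\<in>(UNIV::'v set). real CARD('v) * q ^ k)"
      by (intro sum_mono row)
    finally show ?thesis by (simp add: B_def)
  qed
  have s: "summable (\<lambda>k. B * (q ^ k /\<^sub>R fact k))"
    by (intro summable_mult summable_exp_generic)
  show ?thesis
    by (rule summable_comparison_test'[OF s, of 0])
      (use bound in \<open>auto simp: field_simps divide_right_mono\<close>)
qed

definition transition :: "complex ^ 'v ^ 'v \<Rightarrow> real \<Rightarrow> complex ^ 'v ^ 'v::finite" where
  "transition H t = mat_exp (\<chi> u v. - \<i> * complex_of_real t * H $ u $ v)"

definition zero_transfer :: "complex ^ 'v ^ 'v \<Rightarrow> 'v \<Rightarrow> 'v::finite \<Rightarrow> bool" where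
  "zero_transfer H u v \<longleftrightarrow> (\<forall>t\<ge>0. transition H t $ u $ v = 0)"

definition eigenspace :: "complex ^ 'v ^ 'v \<Rightarrow> complex \<Rightarrow> (complex ^ 'v::finite) set" where
  "eigenspace H \<theta> = {x. H *v x = \<theta> *s x}"

definition eigenvalues :: "complex ^ 'v ^ 'v::finite \<Rightarrow> complex set" where
  "eigenvalues H = {\<theta>. \<exists>x. x \<noteq> 0 \<and> H *v x = \<theta> *s x}"

text \<open>The library inner product on \<^typ>\<open>complex ^ 'v\<close> is the real part of this one.\<close>

definition cinner :: "complex ^ 'v \<Rightarrow> complex ^ 'v::finite \<Rightarrow> complex" where
  "cinner x y = (\<Sum>i\<in>UNIV. x $ i * cnj (y $ i))"

definition is_orth_proj :: "complex ^ 'v ^ 'v \<Rightarrow> (complex ^ 'v::finite) set \<Rightarrow> bool" where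
  "is_orth_proj P S \<longleftrightarrow> (\<forall>x. P *v x \<in> S \<and> (\<forall>y\<in>S. cinner (x - P *v x) y = 0))"

definition spectral_idem :: "complex ^ 'v ^ 'v \<Rightarrow> complex \<Rightarrow> complex ^ 'v ^ 'v::finite" where
  "spectral_idem H \<theta> = (THE P. is_orth_proj P (eigenspace H \<theta>))"

lemma Re_cinner: "Re (cinner x y) = x \<bullet> y"
  by (simp add: cinner_def inner_vec_def inner_complex_def)

lemma cinner_diff_left: "cinner (x - y) z = cinner x z - cinner y z"
  by (simp add: cinner_def algebra_simps sum_subtractf)

lemma cinner_eq_0_if_orthogonal:
  assumes "\<And>y. y \<in> S \<Longrightarrow> orthogonal z y" "\<And>c y. y \<in> S \<Longrightarrow> c *s y \<in> S" "y \<in> S"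
  shows "cinner z y = 0"
proof (rule complex_eqI)
  show "Re (cinner z y) = Re 0"
    using assms by (simp add: Re_cinner orthogonal_def)
  have "cinner z (\<i> *s y) = - \<i> * cinner z y"
    by (simp add: cinner_def sum_distrib_left mult_ac)
  then have "Im (cinner z y) = Re (cinner z (\<i> *s y))"
    by simp
  also have "\<dots> = 0"
    using assms by (simp add: Re_cinner orthogonal_def)
  finally show "Im (cinner z y) = Im 0" by simp
qed

lemma eigenspace_closed:
  "0 \<in> eigenspace H \<theta>"
  "x \<in> eigenspace H \<theta> \<Longrightarrow> y \<in> eigenspace H \<theta> \<Longrightarrow> x + y \<in> eigenspace H \<theta>"
  "x \<in> eigenspace H \<theta> \<Longrightarrow> c *s x \<in> eigenspace H \<theta>"
  by (auto simp: eigenspace_def matrix_vector_right_distrib vector_add_ldistrib vec.scale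
      vector_scalar_commute vector_smult_assoc mult.commute)

lemma is_orth_proj_unique:
  fixes x y y' :: "complex ^ 'v::finite"
  assumes "y \<in> eigenspace H \<theta>" "\<And>w. w \<in> eigenspace H \<theta> \<Longrightarrow> cinner (x - y) w = 0"
    "y' \<in> eigenspace H \<theta>" "\<And>w. w \<in> eigenspace H \<theta> \<Longrightarrow> cinner (x - y') w = 0"
  shows "y = y'"
proof -
  have "y + (- 1) *s y' \<in> eigenspace H \<theta>"
    using assms eigenspace_closed by blast
  then have m: "y - y' \<in> eigenspace H \<theta>" by simp
  have "cinner (y - y') (y - y') = cinner (x - y') (y - y') - cinner (x - y) (y - y')"
    by (simp add: cinner_diff_left)
  then have "cinner (y - y') (y - y') = 0" using assms m by simp
  then have "(y - y') \<bullet> (y - y') = 0" by (metis Re_cinner zero_complex.simps(1))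
  then show ?thesis by simp
qed

lemma is_orth_proj_spectral_idem:
  fixes H :: "complex ^ 'v ^ 'v::finite"
  shows "is_orth_proj (spectral_idem H \<theta>) (eigenspace H \<theta>)"
proof -
  let ?S = "eigenspace H \<theta>"
  have scR: "r *\<^sub>R x = complex_of_real r *s x" for r and x :: "complex ^ 'v"
    by (simp add: vec_eq_iff scaleR_conv_of_real[where 'a=complex])
  have sub: "subspace ?S"
    unfolding subspace_def by (auto simp: scR eigenspace_closed)
  then have span: "span ?S = ?S" by (simp add: span_eq_iff)
  have "\<exists>y. y \<in> ?S \<and> (\<forall>w\<in>?S. cinner (x - y) w = 0)" for x
  proof -
    obtain y z where "y \<in> span ?S" "\<And>w. w \<in> span ?S \<Longrightarrow> orthogonal z w" "x = y + z"
      using orthogonal_subspace_decomp_exists[of ?S x] by metis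
    moreover from this have "x - y = z" by simp
    ultimately show ?thesis
      using cinner_eq_0_if_orthogonal[of ?S z] eigenspace_closed(3) unfolding span by metis
  qed
  then obtain f where f: "\<And>x. f x \<in> ?S" "\<And>x w. w \<in> ?S \<Longrightarrow> cinner (x - f x) w = 0"
    by metis
  have add: "f (x + y) = f x + f y" for x y
  proof (rule is_orth_proj_unique[of _ H \<theta> "x + y"])
    fix w assume w: "w \<in> ?S"
    have "cinner (x + y - (f x + f y)) w = cinner (x - f x) w + cinner (y - f y) w"
      by (simp add: cinner_def algebra_simps sum.distrib sum_subtractf)
    then show "cinner (x + y - (f x + f y)) w = 0" using f(2)[OF w] by simp
  qed (simp_all add: f eigenspace_closed)
  have scale: "f (c *s x) = c *s f x" for c x
  proof (rule is_orth_proj_unique[of _ H \<theta> "c *s x"])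
    fix w assume w: "w \<in> ?S"
    have "cinner (c *s x - c *s f x) w = c * cinner (x - f x) w"
      by (simp add: cinner_def algebra_simps sum_distrib_left sum_subtractf)
    then show "cinner (c *s x - c *s f x) w = 0" using f(2)[OF w] by simp
  qed (simp_all add: f eigenspace_closed)
  have "Vector_Spaces.linear (*s) (*s) f"
    by (simp add: Vector_Spaces.linear_iff add scale vec.vector_space_axioms)
  then have "matrix f *v x = f x" for x
    by (rule matrix_works)
  then have ex: "is_orth_proj (matrix f) ?S"
    using f by (simp add: is_orth_proj_def)
  have "P = matrix f" if "is_orth_proj P ?S" for P
  proof -
    have "P *v x = matrix f *v x" for x
      using that ex unfolding is_orth_proj_def
      by (intro is_orth_proj_unique[of _ H \<theta> x]) auto
    then show ?thesis by (simp add: matrix_eq)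
  qed
  with ex show ?thesis
    unfolding spectral_idem_def by (rule theI)
qed

definition eig_support :: "complex ^ 'v ^ 'v \<Rightarrow> 'v::finite \<Rightarrow> complex set" where
  "eig_support H a = {\<theta> \<in> eigenvalues H. spectral_idem H \<theta> *v axis a 1 \<noteq> 0}"

end

theory Submission
  imports Defs "HOL-Complex_Analysis.Cauchy_Integral_Formula"
    "HOL-Computational_Algebra.Fundamental_Theorem_Algebra"
begin

text \<open>The entry \<open>U(t)\<^sub>u\<^sub>v\<close> is a power series in \<open>t\<close> with coefficients
  \<open>(- \<i>)\<^sup>k (H\<^sup>k)\<^sub>u\<^sub>v / k!\<close>, so by isolation of zeros it vanishes for all \<open>t \<ge> 0\<close> iff
  \<open>(H\<^sup>k)\<^sub>u\<^sub>v = 0\<close> for every \<open>k\<close>. By the spectral theorem \<open>H\<^sup>k\<close> is the sum of the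
  \<open>\<theta>\<^sup>k E\<^sub>\<theta>\<close>, and a polynomial vanishing at all eigenvalues but \<open>\<theta>\<close> isolates
  \<open>(E\<^sub>\<theta>)\<^sub>u\<^sub>v\<close>. The statement on supports holds because \<open>(E\<^sub>\<theta>)\<^sub>u\<^sub>v\<close> is the inner product of
  \<open>E\<^sub>\<theta> e\<^sub>v\<close> and \<open>E\<^sub>\<theta> e\<^sub>u\<close>.\<close>

section \<open>The Hermitian form on complex vectors\<close>

lemma cinner_add_left: "cinner (x + y) z = cinner x z + cinner y z"
  by (simp add: cinner_def algebra_simps sum.distrib)

lemma cinner_scale_left: "cinner (c *s x) y = c * cinner x y"
  by (simp add: cinner_def sum_distrib_left mult_ac)

lemma cinner_scale_right: "cinner x (c *s y) = cnj c * cinner x y"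
  by (simp add: cinner_def sum_distrib_left mult_ac)

lemma cinner_zero_left: "cinner 0 y = 0"
  by (simp add: cinner_def)

lemma cinner_zero_right: "cinner x 0 = 0"
  by (simp add: cinner_def)

lemma cinner_sum_left: "cinner (sum f S) y = (\<Sum>i\<in>S. cinner (f i) y)"
  by (induction S rule: infinite_finite_induct) (simp_all add: cinner_add_left cinner_zero_left)

lemma cnj_cinner: "cnj (cinner x y) = cinner y x"
  by (simp add: cinner_def mult.commute)

lemma cinner_axis_right: "cinner x (axis a 1) = x $ a"
proof -
  have "cinner x (axis a 1) = (\<Sum>i\<in>UNIV. if i = a then x $ i else 0)"
    unfolding cinner_def by (intro sum.cong) (auto simp: axis_def)
  then show ?thesis by simp
qed

lemma cinner_self_eq_0: "cinner x x = 0 \<longleftrightarrow> x = 0"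
proof
  assume "cinner x x = 0"
  then have "x \<bullet> x = 0" by (simp flip: Re_cinner)
  then show "x = 0" by simp
qed (simp add: cinner_zero_left)

section \<open>Eigenvalues and eigenspaces of a Hermitian matrix\<close>

lemma cinner_hermitian:
  assumes "\<And>i j. H $ j $ i = cnj (H $ i $ j)"
  shows "cinner (H *v x) y = cinner x (H *v y)"
proof -
  have "cinner (H *v x) y = (\<Sum>i\<in>UNIV. \<Sum>j\<in>UNIV. H $ i $ j * x $ j * cnj (y $ i))"
    by (simp add: cinner_def matrix_vector_mult_def sum_distrib_right)
  also have "\<dots> = (\<Sum>j\<in>UNIV. \<Sum>i\<in>UNIV. H $ i $ j * x $ j * cnj (y $ i))"
    by (rule sum.swap)
  also have "\<dots> = (\<Sum>j\<in>UNIV. \<Sum>i\<in>UNIV. x $ j * cnj (H $ j $ i * y $ i))"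
    by (intro sum.cong refl) (simp add: assms[symmetric] mult_ac)
  also have "\<dots> = cinner x (H *v y)"
    by (simp add: cinner_def matrix_vector_mult_def sum_distrib_left)
  finally show ?thesis .
qed

text \<open>Moving \<open>H\<close> across the form pulls out \<theta> on one side and its conjugate
  on the other, while \<open>cinner x x\<close> is nonzero.\<close>

lemma eigenvalue_hermitian_real:
  assumes H: "\<And>i j. H $ j $ i = cnj (H $ i $ j)" and "H *v x = \<theta> *s x" "x \<noteq> 0"
  shows "cnj \<theta> = \<theta>"
proof -
  have "\<theta> * cinner x x = cnj \<theta> * cinner x x"
    using cinner_hermitian[OF H, of x x] assms(2)
    by (simp add: cinner_scale_left cinner_scale_right)
  then show ?thesis using \<open>x \<noteq> 0\<close> by (simp add: cinner_self_eq_0)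
qed

lemma eigenspaces_orthogonal:
  assumes H: "\<And>i j. H $ j $ i = cnj (H $ i $ j)"
    and "x \<in> eigenspace H \<theta>" "y \<in> eigenspace H \<mu>" "\<theta> \<noteq> \<mu>"
  shows "cinner x y = 0"
\<comment> \<open>The zero vector is split off because a nonzero \<open>y\<close> is what makes
  \<mu> an eigenvalue and hence real.\<close>
proof (cases "y = 0")
  case False
  have "\<theta> * cinner x y = cnj \<mu> * cinner x y"
    using cinner_hermitian[OF H, of x y] assms(2,3)
    by (simp add: eigenspace_def cinner_scale_left cinner_scale_right)
  moreover have "cnj \<mu> = \<mu>"
    using eigenvalue_hermitian_real[OF H _ False] assms(3) by (simp add: eigenspace_def)
  ultimately show ?thesis using \<open>\<theta> \<noteq> \<mu>\<close> by simp
qed (simp add: cinner_zero_right)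

text \<open>Choose one eigenvector per eigenvalue: nonzero pairwise orthogonal vectors are
  independent over the reals, hence finite in number.\<close>

lemma finite_eigenvalues:
  fixes H :: "complex ^ 'v ^ 'v::finite"
  assumes H: "\<And>i j. H $ j $ i = cnj (H $ i $ j)"
  shows "finite (eigenvalues H)"
proof -
  have "\<forall>\<theta>\<in>eigenvalues H. \<exists>x. x \<noteq> 0 \<and> x \<in> eigenspace H \<theta>"
    by (auto simp: eigenvalues_def eigenspace_def)
  then obtain w where w: "\<And>\<theta>. \<theta> \<in> eigenvalues H \<Longrightarrow> w \<theta> \<noteq> 0"
    "\<And>\<theta>. \<theta> \<in> eigenvalues H \<Longrightarrow> w \<theta> \<in> eigenspace H \<theta>"
    by metis
  have orth: "cinner (w \<theta>) (w \<mu>) = 0"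
    if "\<theta> \<in> eigenvalues H" "\<mu> \<in> eigenvalues H" "\<theta> \<noteq> \<mu>" for \<theta> \<mu>
    using eigenspaces_orthogonal[OF H] w that by blast
  \<comment> \<open>A vector chosen for two different eigenvalues would be orthogonal to
    itself.\<close>
  have inj: "inj_on w (eigenvalues H)"
    by (metis inj_onI orth cinner_self_eq_0 w(1))
  have "pairwise orthogonal (w ` eigenvalues H)"
    by (auto simp: pairwise_def orthogonal_def Re_cinner[symmetric]) (metis orth zero_complex.simps(1))
  moreover have "0 \<notin> w ` eigenvalues H" using w(1) by force
  ultimately have "independent (w ` eigenvalues H)"
    by (rule pairwise_orthogonal_independent)
  then have "finite (w ` eigenvalues H)" by (rule independent_imp_finite)
  then show ?thesis using inj by (rule finite_imageD)
qed

section \<open>Polynomials in a matrix, and eigenvectors in invariant subspaces\<close>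

text \<open>This is the vector \<open>p(H) x\<close>.\<close>

definition poly_act :: "complex poly \<Rightarrow> complex ^ 'v ^ 'v \<Rightarrow> complex ^ 'v \<Rightarrow> complex ^ 'v::finite" where
  "poly_act p H x = (\<Sum>k\<le>degree p. coeff p k *s (mat_pow H k *v x))"

text \<open>Any bound on the degree serves as summation range, so polynomials of different degrees
  can be combined coefficientwise.\<close>

lemma poly_act_eq:
  "degree p \<le> n \<Longrightarrow> poly_act p H x = (\<Sum>k\<le>n. coeff p k *s (mat_pow H k *v x))"
  unfolding poly_act_def by (intro sum.mono_neutral_left) (auto simp: coeff_eq_0)

lemma mat_pow_0: "mat_pow H 0 = mat 1"
  by (simp add: mat_pow_def)

lemma mat_pow_Suc: "mat_pow H (Suc k) = H ** mat_pow H k"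
  by (simp add: mat_pow_def)

lemma mat_pow_Suc_right: "mat_pow H (Suc k) = mat_pow H k ** H"
proof (induction k)
  case (Suc k)
  have "mat_pow H (Suc (Suc k)) = H ** (mat_pow H k ** H)"
    by (simp only: mat_pow_Suc[of H "Suc k"] Suc)
  then show ?case by (simp only: matrix_mul_assoc mat_pow_Suc[of H k])
qed (simp add: mat_pow_0 mat_pow_Suc)

lemma poly_act_pCons_0: "poly_act (pCons 0 p) H x = poly_act p H (H *v x)"
proof -
  have "poly_act (pCons 0 p) H x
      = (\<Sum>k\<le>Suc (degree p). coeff (pCons 0 p) k *s (mat_pow H k *v x))"
    by (rule poly_act_eq) (rule degree_pCons_le)
  also have "\<dots> = (\<Sum>k\<le>degree p. coeff p k *s (mat_pow H (Suc k) *v x))"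
    by (simp only: sum.atMost_Suc_shift coeff_pCons_0 coeff_pCons_Suc) simp
  also have "\<dots> = poly_act p H (H *v x)"
    by (simp add: poly_act_def mat_pow_Suc_right matrix_vector_mul_assoc)
  finally show ?thesis .
qed

text \<open>Powers of \<open>H\<close> commute with \<open>H\<close>, so a linear factor may act on
  the vector first. This allows roots to be split off one at a time.\<close>

lemma poly_act_linear_factor:
  "poly_act ([:- \<theta>, 1:] * p) H x = poly_act p H (H *v x - \<theta> *s x)"
proof -
  define n where "n = Suc (degree p)"
  have n: "degree (smult (- \<theta>) p) \<le> n" "degree (pCons 0 p) \<le> n" "degree p \<le> n"
    using degree_smult_le[of "-\<theta>" p] degree_pCons_le[of 0 p] by (auto simp: n_def)
  then have "degree (smult (- \<theta>) p + pCons 0 p) \<le> n"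
    by (intro degree_add_le)
  moreover have "[:- \<theta>, 1:] * p = smult (- \<theta>) p + pCons 0 p"
    by (simp add: mult_pCons_left)
  ultimately have "poly_act ([:- \<theta>, 1:] * p) H x
      = (\<Sum>k\<le>n. coeff (smult (- \<theta>) p) k *s (mat_pow H k *v x))
        + (\<Sum>k\<le>n. coeff (pCons 0 p) k *s (mat_pow H k *v x))"
    by (simp only: poly_act_eq coeff_add vector_sadd_rdistrib sum.distrib)
  also have "\<dots> = (\<Sum>k\<le>n. coeff (smult (- \<theta>) p) k *s (mat_pow H k *v x)) + poly_act p H (H *v x)"
    by (simp only: poly_act_eq[OF n(2), symmetric] poly_act_pCons_0)
  also have "poly_act p H (H *v x) = (\<Sum>k\<le>n. coeff p k *s (mat_pow H k *v (H *v x)))"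
    by (rule poly_act_eq[OF n(3)])
  also have "(\<Sum>k\<le>n. coeff (smult (- \<theta>) p) k *s (mat_pow H k *v x)) + \<dots>
      = (\<Sum>k\<le>n. coeff p k *s (mat_pow H k *v (H *v x - \<theta> *s x)))"
    unfolding sum.distrib[symmetric]
    by (intro sum.cong refl)
      (simp add: matrix_vector_mult_diff_distrib vector_scalar_commute vector_smult_assoc
        vector_ssub_ldistrib mult.commute)
  also have "\<dots> = poly_act p H (H *v x - \<theta> *s x)"
    by (rule poly_act_eq[OF n(3), symmetric])
  finally show ?thesis .
qed

text \<open>The iterates of \<open>x\<close> under \<open>H\<close> lie in a finite-dimensional
  space. Either two of them coincide, which gives a difference of monomials, or the first
  \<open>n + 1\<close> are distinct and hence linearly dependent.\<close>

lemma annihilating_poly_exists: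
  fixes H :: "complex ^ 'v ^ 'v::finite"
  obtains p where "p \<noteq> 0" "poly_act p H x = 0"
proof (cases "inj (\<lambda>k. mat_pow H k *v x)")
  case False
  then obtain j k where jk: "j \<noteq> k" "mat_pow H j *v x = mat_pow H k *v x"
    by (auto simp: inj_def)
  let ?p = "monom 1 j - monom 1 k :: complex poly"
  define n where "n = max j k"
  have "coeff ?p j \<noteq> 0" using jk(1) by simp
  then have "?p \<noteq> 0" by (metis coeff_0)
  moreover have "poly_act ?p H x = 0"
  proof -
    have "degree ?p \<le> n"
      by (intro degree_diff_le) (auto simp: degree_monom_eq n_def)
    then have "poly_act ?p H x = (\<Sum>i\<le>n. coeff ?p i *s (mat_pow H i *v x))"
      by (rule poly_act_eq)
    also have "\<dots> = (\<Sum>i\<le>n. (if i = j then mat_pow H i *v x else 0)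
        - (if i = k then mat_pow H i *v x else 0))"
      by (intro sum.cong refl) auto
    also have "\<dots> = 0" using jk(2) by (simp add: sum_subtractf n_def)
    finally show ?thesis .
  qed
  ultimately show ?thesis by (rule that)
next
  case True
  define f where "f k = mat_pow H k *v x" for k
  \<comment> \<open>This is the dimension over the reals; the dependence has real coefficients,
    which are then embedded into the complex numbers.\<close>
  define n where "n = DIM(complex ^ 'v)"
  have inj: "inj_on f {..n}" using True unfolding f_def by (rule inj_on_subset) simp
  have "card (f ` {..n}) = Suc n" using inj by (simp add: card_image)
  then have "dependent (f ` {..n})"
    by (intro dependent_biggerset) (simp add: n_def)
  then obtain c i where c: "i \<le> n" "c (f i) \<noteq> 0" "(\<Sum>y\<in>f ` {..n}. c y *\<^sub>R y) = 0"
    by (auto simp: dependent_finite)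
  define p where "p = (\<Sum>k\<le>n. monom (complex_of_real (c (f k))) k)"
  have cp: "coeff p k = (if k \<le> n then complex_of_real (c (f k)) else 0)" for k
    by (simp add: p_def coeff_sum)
  have "p \<noteq> 0"
    using cp[of i] c(1,2) by (metis coeff_0 of_real_eq_0_iff)
  moreover have "degree p \<le> n" by (intro degree_le) (simp add: cp)
  then have "poly_act p H x = (\<Sum>k\<le>n. c (f k) *\<^sub>R f k)"
    by (subst poly_act_eq, assumption)
      (auto simp: cp f_def vec_eq_iff scaleR_conv_of_real[where 'a=complex] intro!: sum.cong)
  then have "poly_act p H x = 0"
    using c(3) inj by (simp add: sum.reindex)
  ultimately show ?thesis by (rule that)
qed

text \<open>Induction on the degree: for a root \<theta> of \<open>p\<close>, either
  \<open>x\<close> is an eigenvector for \<theta>, or \<open>H *v x - \<theta> *s x\<close> is a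
  nonzero vector that still satisfies \<open>P\<close> and is annihilated by the quotient.\<close>

lemma eigenvector_if_annihilated:
  assumes "p \<noteq> 0" "poly_act p H x = 0" "x \<noteq> 0" "P x"
    and inv: "\<And>\<theta> y. P y \<Longrightarrow> P (H *v y - \<theta> *s y)"
  shows "\<exists>\<theta> y. P y \<and> y \<noteq> 0 \<and> H *v y = \<theta> *s y"
  using assms(1-4)
proof (induction "degree p" arbitrary: p x)
  case 0
  \<comment> \<open>A nonzero constant cannot annihilate the nonzero vector \<open>x\<close>, so
    this case is contradictory.\<close>
  then obtain a where "p = [:a:]" by (metis degree_eq_zeroE)
  then show ?case using 0 by (simp add: poly_act_def mat_pow_0)
next
  case (Suc n)
  then have "\<not> constant (poly p)" by (simp add: constant_degree)
  then obtain \<theta> where "poly p \<theta> = 0" using fundamental_theorem_of_algebra by blast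
  then obtain q where q: "p = [:- \<theta>, 1:] * q" by (metis dvdE poly_eq_0_iff_dvd)
  then have "q \<noteq> 0" using Suc.prems by auto
  then have "degree p = degree [:- \<theta>, 1:] + degree q"
    unfolding q by (intro degree_mult_eq) auto
  then have dq: "n = degree q" using Suc.hyps(2) by simp
  show ?case
  proof (cases "H *v x - \<theta> *s x = 0")
    case True
    then show ?thesis using Suc.prems by auto
  next
    case False
    moreover have "poly_act q H (H *v x - \<theta> *s x) = 0"
      using Suc.prems(2) unfolding q poly_act_linear_factor .
    ultimately show ?thesis
      using Suc.hyps(1)[OF dq \<open>q \<noteq> 0\<close>] inv Suc.prems(4) by blast
  qed
qed

text \<open>The vectors orthogonal to all eigenspaces form an invariant subspace, so a nonzero one would
  yield an eigenvector in it, orthogonal to itself.\<close>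

lemma eigenspaces_complete:
  fixes H :: "complex ^ 'v ^ 'v::finite"
  assumes H: "\<And>i j. H $ j $ i = cnj (H $ i $ j)"
    and x: "\<And>\<theta> w. w \<in> eigenspace H \<theta> \<Longrightarrow> cinner x w = 0"
  shows "x = 0"
proof (rule ccontr)
  assume "x \<noteq> 0"
  define P where "P y \<longleftrightarrow> (\<forall>\<theta>. \<forall>w\<in>eigenspace H \<theta>. cinner y w = 0)" for y
  obtain p where "p \<noteq> 0" "poly_act p H x = 0" by (rule annihilating_poly_exists)
  moreover have "P x" using x by (simp add: P_def)
  \<comment> \<open>For \<open>w\<close> in an eigenspace, self-adjointness turns the pairing of
    \<open>H *v y\<close> with \<open>w\<close> into a multiple of
    \<open>cinner y w\<close>.\<close>
  moreover have "P (H *v y - \<theta> *s y)" if "P y" for \<theta> y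
    using that by (auto simp: P_def cinner_diff_left cinner_scale_left cinner_hermitian[OF H]
        eigenspace_def cinner_scale_right)
  ultimately obtain \<theta> y where "P y" "y \<noteq> 0" "H *v y = \<theta> *s y"
    using eigenvector_if_annihilated[of p H x P] \<open>x \<noteq> 0\<close> by blast
  then have "cinner y y = 0" by (auto simp: P_def eigenspace_def)
  then show False using \<open>y \<noteq> 0\<close> by (simp add: cinner_self_eq_0)
qed

section \<open>Spectral decomposition of the powers of a Hermitian matrix\<close>

lemma spectral_idem_in_eigenspace: "spectral_idem H \<theta> *v x \<in> eigenspace H \<theta>"
  using is_orth_proj_spectral_idem[of H \<theta>] unfolding is_orth_proj_def by blast

lemma cinner_spectral_idem:
  assumes "w \<in> eigenspace H \<theta>"
  shows "cinner (spectral_idem H \<theta> *v x) w = cinner x w"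
proof -
  have "cinner (x - spectral_idem H \<theta> *v x) w = 0"
    using is_orth_proj_spectral_idem[of H \<theta>] assms unfolding is_orth_proj_def by blast
  then show ?thesis by (simp add: cinner_diff_left)
qed

text \<open>Against \<open>w\<close> in the eigenspace of \<mu>, only the summand for \<mu>
  survives, and it pairs like \<open>x\<close>. The remainder is thus orthogonal to all eigenspaces
  and vanishes by completeness.\<close>

lemma sum_spectral_idem:
  fixes H :: "complex ^ 'v ^ 'v::finite"
  assumes H: "\<And>i j. H $ j $ i = cnj (H $ i $ j)"
  shows "(\<Sum>\<theta>\<in>eigenvalues H. spectral_idem H \<theta> *v x) = x"
proof -
  define s where "s = (\<Sum>\<theta>\<in>eigenvalues H. spectral_idem H \<theta> *v x)"
  have "cinner (x - s) w = 0" if w: "w \<in> eigenspace H \<mu>" for \<mu> w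
  \<comment> \<open>A nonzero \<open>w\<close> ensures that \<mu> occurs in the index set of the
    sum.\<close>
  proof (cases "w = 0")
    case False
    then have "\<mu> \<in> eigenvalues H" using w by (auto simp: eigenvalues_def eigenspace_def)
    moreover have "cinner (spectral_idem H \<theta> *v x) w = (if \<theta> = \<mu> then cinner x w else 0)" for \<theta>
      using w cinner_spectral_idem eigenspaces_orthogonal[OF H spectral_idem_in_eigenspace] by auto
    ultimately show ?thesis
      by (simp add: s_def cinner_diff_left cinner_sum_left finite_eigenvalues[OF H])
  qed (simp add: cinner_zero_right)
  then have "x - s = 0" by (rule eigenspaces_complete[OF H])
  then show ?thesis by (simp add: s_def)
qed

lemma mat_pow_eigenvector:
  assumes "x \<in> eigenspace H \<theta>"
  shows "mat_pow H k *v x = \<theta> ^ k *s x"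
proof (induction k)
  case (Suc k)
  have "mat_pow H (Suc k) *v x = H *v (mat_pow H k *v x)"
    by (simp only: mat_pow_Suc matrix_vector_mul_assoc)
  also have "\<dots> = \<theta> ^ k *s (H *v x)"
    by (simp only: Suc vector_scalar_commute)
  also have "\<dots> = \<theta> ^ Suc k *s x"
    using assms by (simp add: eigenspace_def vector_smult_assoc mult.commute)
  finally show ?case .
qed (simp add: mat_pow_0)

lemma matrix_vector_mult_axis: "(M *v axis v 1) $ u = M $ u $ v"
  for M :: "complex ^ 'v ^ 'v::finite"
proof -
  have "(M *v axis v 1) $ u = (\<Sum>j\<in>UNIV. if j = v then M $ u $ j else 0)"
    by (simp add: matrix_vector_mult_def axis_def if_distrib cong: if_cong)
  then show ?thesis by simp
qed

lemma mat_pow_spectral: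
  fixes H :: "complex ^ 'v ^ 'v::finite"
  assumes H: "\<And>i j. H $ j $ i = cnj (H $ i $ j)"
  shows "mat_pow H k $ u $ v = (\<Sum>\<theta>\<in>eigenvalues H. \<theta> ^ k * spectral_idem H \<theta> $ u $ v)"
proof -
  have "mat_pow H k *v axis v 1
      = mat_pow H k *v (\<Sum>\<theta>\<in>eigenvalues H. spectral_idem H \<theta> *v axis v 1)"
    by (simp add: sum_spectral_idem[OF H])
  also have "\<dots> = (\<Sum>\<theta>\<in>eigenvalues H. mat_pow H k *v (spectral_idem H \<theta> *v axis v 1))"
    by (rule linear_sum[OF matrix_vector_mul_linear])
  also have "\<dots> = (\<Sum>\<theta>\<in>eigenvalues H. \<theta> ^ k *s (spectral_idem H \<theta> *v axis v 1))"
    by (simp add: mat_pow_eigenvector[OF spectral_idem_in_eigenspace])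
  finally have "(mat_pow H k *v axis v 1) $ u
      = (\<Sum>\<theta>\<in>eigenvalues H. \<theta> ^ k *s (spectral_idem H \<theta> *v axis v 1)) $ u"
    by simp
  then show ?thesis by (simp add: matrix_vector_mult_axis)
qed

text \<open>A Vandermonde argument: by linearity the vanishing for monomials extends to all
  polynomials, in particular to the Lagrange polynomial of \<theta>, here left unnormalised.\<close>

lemma power_sums_zero_imp_zero:
  fixes a :: "complex \<Rightarrow> complex"
  assumes "finite S" "\<And>k. (\<Sum>\<theta>\<in>S. \<theta> ^ k * a \<theta>) = 0" "\<theta> \<in> S"
  shows "a \<theta> = 0"
proof -
  define p where "p = (\<Prod>\<mu>\<in>S - {\<theta>}. [:- \<mu>, 1:])"
  have "(\<Sum>\<mu>\<in>S. poly p \<mu> * a \<mu>) = (\<Sum>\<mu>\<in>S. \<Sum>k\<le>degree p. coeff p k * (\<mu> ^ k * a \<mu>))"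
    by (simp add: poly_altdef sum_distrib_right mult.assoc)
  also have "\<dots> = (\<Sum>k\<le>degree p. coeff p k * (\<Sum>\<mu>\<in>S. \<mu> ^ k * a \<mu>))"
    by (subst sum.swap) (simp add: sum_distrib_left)
  finally have "(\<Sum>\<mu>\<in>S. poly p \<mu> * a \<mu>) = 0" using assms(2) by simp
  moreover have "poly p \<mu> = 0" if "\<mu> \<in> S - {\<theta>}" for \<mu>
    using that assms(1) by (simp add: p_def poly_prod prod_zero_iff)
  ultimately have "poly p \<theta> * a \<theta> = 0"
    using assms(1,3) by (simp add: sum.remove)
  moreover have "poly p \<theta> \<noteq> 0"
    using assms(1) by (auto simp: p_def poly_prod prod_zero_iff)
  ultimately show ?thesis by simp
qed

section \<open>Power series of the transition matrix\<close>

lemma mat_pow_scale: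
  "mat_pow (\<chi> i j. z * H $ i $ j) k $ u $ v = z ^ k * mat_pow H k $ u $ v"
proof (induction k arbitrary: u)
  case (Suc k)
  have "mat_pow (\<chi> i j. z * H $ i $ j) (Suc k) $ u $ v
      = (\<Sum>l\<in>UNIV. z * H $ u $ l * (z ^ k * mat_pow H k $ l $ v))"
    by (simp add: mat_pow_Suc matrix_matrix_mult_def Suc)
  also have "\<dots> = z ^ Suc k * mat_pow H (Suc k) $ u $ v"
    by (simp add: mat_pow_Suc matrix_matrix_mult_def sum_distrib_left mult_ac)
  finally show ?case .
qed (simp add: mat_pow_0 mat_def)

text \<open>With a complex scalar \<open>z\<close> as variable, each entry of the exponential is a
  scalar power series, to which isolation of zeros applies.\<close>

lemma mat_exp_scale_sums:
  "(\<lambda>k. mat_pow H k $ u $ v / fact k * z ^ k) sums (mat_exp (\<chi> i j. z * H $ i $ j) $ u $ v)"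
proof -
  let ?M = "\<chi> i j. z * H $ i $ j"
  have "(\<lambda>k. (1 / fact k) *\<^sub>R mat_pow ?M k) sums mat_exp ?M"
    unfolding mat_exp_def by (rule summable_sums[OF mat_exp_summable])
  then have "(\<lambda>k. ((1 / fact k) *\<^sub>R mat_pow ?M k) $ u $ v) sums (mat_exp ?M $ u $ v)"
    by (intro bounded_linear.sums[OF bounded_linear_vec_nth])
  then show ?thesis
    by (simp add: mat_pow_scale scaleR_conv_of_real[where 'a=complex] mult_ac)
qed

lemma zero_transfer_iff_mat_pow:
  "zero_transfer H u v \<longleftrightarrow> (\<forall>k. mat_pow H k $ u $ v = 0)"
proof
  assume z: "zero_transfer H u v"
  define f where "f z = mat_exp (\<chi> i j. z * H $ i $ j) $ u $ v" for z
  define a where "a k = mat_pow H k $ u $ v / fact k" for k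
  have f: "(\<lambda>k. a k * z ^ k) sums f z" for z
    unfolding a_def f_def by (rule mat_exp_scale_sums)
  have f0: "f (- \<i> * complex_of_real t) = 0" if "t \<ge> 0" for t
    using z that by (simp add: zero_transfer_def transition_def f_def)
  \<comment> \<open>The constant term is the value at time 0. It is treated first because
    \<open>powser_0_nonzero\<close> asks for a zero at the centre and a nonzero coefficient of
    positive index.\<close>
  have a0: "a 0 = 0" using f0[of 0] f[of 0] by (simp add: sums_iff)
  have "a k = 0" for k
  proof (rule ccontr)
    assume "a k \<noteq> 0"
    moreover from this a0 have "k > 0" by (metis gr0I)
    ultimately obtain s where s: "s > 0" "\<And>z. z \<in> cball 0 s - {0} \<Longrightarrow> f z \<noteq> 0"
      using powser_0_nonzero[of 1 0 a f k] f f0[of 0] by auto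
    \<comment> \<open>The point for time \<open>s\<close> has modulus \<open>s\<close>, so it lies
      on the boundary of the closed disc, where \<open>f\<close> is nonzero.\<close>
    have "f (- \<i> * complex_of_real s) \<noteq> 0"
      using s(1) by (intro s(2)) (simp add: norm_mult)
    then show False using f0 s(1) by simp
  qed
  then show "\<forall>k. mat_pow H k $ u $ v = 0" by (simp add: a_def)
next
  assume "\<forall>k. mat_pow H k $ u $ v = 0"
  then have "(\<lambda>k. 0) sums (mat_exp (\<chi> i j. z * H $ i $ j) $ u $ v)" for z
    using mat_exp_scale_sums[of H u v z] by simp
  then have "mat_exp (\<chi> i j. z * H $ i $ j) $ u $ v = 0" for z
    by (rule sums_unique2) (rule sums_zero)
  then show "zero_transfer H u v"
    unfolding zero_transfer_def transition_def by blast
qed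

lemma zero_transfer_iff_spectral_idem:
  fixes H :: "complex ^ 'v ^ 'v::finite"
  assumes H: "\<And>i j. H $ j $ i = cnj (H $ i $ j)"
  shows "zero_transfer H u v \<longleftrightarrow> (\<forall>\<theta>\<in>eigenvalues H. spectral_idem H \<theta> $ u $ v = 0)"
proof -
  have "zero_transfer H u v
      \<longleftrightarrow> (\<forall>k. (\<Sum>\<theta>\<in>eigenvalues H. \<theta> ^ k * spectral_idem H \<theta> $ u $ v) = 0)"
    by (simp only: zero_transfer_iff_mat_pow mat_pow_spectral[OF H])
  also have "\<dots> \<longleftrightarrow> (\<forall>\<theta>\<in>eigenvalues H. spectral_idem H \<theta> $ u $ v = 0)"
  proof (intro iffI ballI)
    fix \<theta> assume "\<forall>k. (\<Sum>\<theta>\<in>eigenvalues H. \<theta> ^ k * spectral_idem H \<theta> $ u $ v) = 0"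
      "\<theta> \<in> eigenvalues H"
    then show "spectral_idem H \<theta> $ u $ v = 0"
      using power_sums_zero_imp_zero[OF finite_eigenvalues[OF H],
          of "\<lambda>\<theta>. spectral_idem H \<theta> $ u $ v" \<theta>] by blast
  qed simp
  finally show ?thesis .
qed

section \<open>Entries of the idempotents and eigenvalue supports\<close>

text \<open>Pairing with a vector of the eigenspace does not distinguish \<open>axis u 1\<close>
  from its projection. The conjugations bring \<open>axis u 1\<close> into the first slot, where
  \<open>cinner_spectral_idem\<close> applies.\<close>

lemma spectral_idem_entry:
  "spectral_idem H \<theta> $ u $ v = cinner (spectral_idem H \<theta> *v axis v 1) (spectral_idem H \<theta> *v axis u 1)"
proof -
  let ?P = "spectral_idem H \<theta>"
  have "?P $ u $ v = cinner (?P *v axis v 1) (axis u 1)"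
    by (simp add: cinner_axis_right matrix_vector_mult_axis)
  also have "\<dots> = cnj (cinner (axis u 1) (?P *v axis v 1))"
    by (simp only: cnj_cinner)
  also have "\<dots> = cnj (cinner (?P *v axis u 1) (?P *v axis v 1))"
    by (simp only: cinner_spectral_idem[OF spectral_idem_in_eigenspace])
  finally show ?thesis by (simp only: cnj_cinner)
qed

text \<open>Outside one of the supports, one of the two projected basis vectors in
  \<open>spectral_idem_entry\<close> is zero.\<close>

lemma spectral_idem_entry_zero_outside_support:
  assumes "\<theta> \<in> eigenvalues H" "\<theta> \<notin> eig_support H u \<inter> eig_support H v"
  shows "spectral_idem H \<theta> $ u $ v = 0"
proof -
  have "spectral_idem H \<theta> *v axis u 1 = 0 \<or> spectral_idem H \<theta> *v axis v 1 = 0"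
    using assms unfolding eig_support_def by blast
  then have "cinner (spectral_idem H \<theta> *v axis v 1) (spectral_idem H \<theta> *v axis u 1) = 0"
    by (metis cinner_zero_left cinner_zero_right)
  then show ?thesis unfolding spectral_idem_entry .
qed

text \<open>Edges are symmetric, and \<open>arc_not_reversed\<close> excludes the case of two
  opposite arcs, in which both entries would be \<open>\<i>\<close> instead of conjugates.\<close>

lemma (in mixed_graph) herm_adj_hermitian: "herm_adj E A $ j $ i = cnj (herm_adj E A $ i $ j)"
proof -
  have "{j, i} = {i, j}" by (rule insert_commute)
  then show ?thesis using arc_not_reversed[of i j] by (simp add: herm_adj_def)
qed

theorem theorem3p2:
  fixes E :: "'v::finite set set" and A :: "('v \<times> 'v) set" and u v :: 'v
  defines "H \<equiv> herm_adj E A"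
  assumes "mixed_graph E A" and "u \<noteq> v"
  shows "(zero_transfer H u v \<longleftrightarrow>
           (\<forall>\<theta>\<in>eigenvalues H. spectral_idem H \<theta> $ u $ v = 0)) \<and>
         ((\<forall>\<theta>\<in>eigenvalues H. spectral_idem H \<theta> $ u $ v = 0) \<longleftrightarrow>
           (eig_support H u \<inter> eig_support H v = {} \<or>
            (\<forall>\<theta>\<in>eig_support H u \<inter> eig_support H v. spectral_idem H \<theta> $ u $ v = 0)))"
proof -
  interpret mixed_graph E A by fact
  have "H $ j $ i = cnj (H $ i $ j)" for i j
    unfolding H_def by (rule herm_adj_hermitian)
  then have "zero_transfer H u v \<longleftrightarrow> (\<forall>\<theta>\<in>eigenvalues H. spectral_idem H \<theta> $ u $ v = 0)"
    by (rule zero_transfer_iff_spectral_idem)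
  \<comment> \<open>Supports consist of eigenvalues, so (ii) restricts to their intersection. The
    converse holds since entries vanish outside it; disjoint supports are the vacuous case.\<close>
  moreover have "\<theta> \<in> eigenvalues H" if "\<theta> \<in> eig_support H a" for \<theta> a
    using that by (simp add: eig_support_def)
  ultimately show ?thesis
    using spectral_idem_entry_zero_outside_support[of _ H u v] by blast
qed

end
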